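(* Let $M\ge 1$ and let $g_1,\dots,g_M\in\mathbb{C}$ be the responses at a target point $(x_0,z_0)$ of $M$ specified Airy beams, i.e. $g_m=\Psi_{\mathrm A}(x_0-x_{c,m},\,z_0-z_{c,m};B_m,F_m,\theta_m)$ for $m=1,\dots,M$, where $\Psi_{\mathrm A}$ is the closed-form Airy field, $(x_{c,m},z_{c,m})$ is the reference center of the $m$-th beam and $(B_m,F_m,\theta_m)$ are its trajectory parameters. Consider the problem of maximizing the target-response power over constant phase offsets, $$\max_{\delta_1,\dots,\delta_M\in\mathbb{R}}\ \left|\sum_{m=1}^{M}e^{\jmath\delta_m}g_m\right|^2 .$$ Then the target-response power $\left|\sum_{m=1}^{M}e^{\jmath\delta_m}g_m\right|^2$ is maximized when all nonzero terms $e^{\jmath\delta_m}g_m$ have the same phase (argument modulo $2\pi$), and the maximum target-response power is $$\left(\sum_{m=1}^{M}|g_m|\right)^2 .$$ Moreover, if $g_m\neq 0$ for $m=1,\dots,M$, then one set of phase offsets that achieves this maximum is $$\delta_m^{(0)}=\phi_0-\varphi_m,\qquad m=1,\dots,M,$$ where $\varphi_m=\arg(g_m)$ and $\phi_0\in\mathbb{R}$ is an arbitrary common phase.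
   Context: $\jmath$ denotes the imaginary unit and $\arg$ the principal argument of a nonzero complex number. Let $\lambda>0$ be the wavelength, $k=2\pi/\lambda$ the wavenumber, and $\omega_0>0$ the Gaussian aperture width. For real $x,z,B,F,\theta$ with $z,B,F\ne 0$, the closed-form Airy field is $$\Psi_{\mathrm A}(x,z;B,F,\theta)=\frac{e^{\jmath kz}}{\jmath\lambda zB}\,e^{\jmath\pi x^2/(\lambda z)}\,e^{\jmath\phi_{\mathrm c}}\,\operatorname{Ai}(\xi),$$ where $\operatorname{Ai}$ is the (entire) Airy function of the first kind and $$\phi_{\mathrm c}=\frac{2C_2^3}{3A^2}-\frac{C_1C_2}{A},\qquad A=(2\pi B)^3,$$ $$C_1=-\left(\frac{2\pi}{\lambda}\sin\theta+\frac{2\pi x}{\lambda z}\right),\qquad C_2=\frac{\pi}{\lambda}\left(\frac1z-\frac1{\widetilde F}\right),\qquad \frac1{\widetilde F}=\frac1F-\jmath\frac{\lambda}{\pi\omega_0^2},$$ $$\xi=-\frac{\sin\theta}{\lambda B}-\frac{x}{\lambda zB}-\frac{(1/z-1/\widetilde F)^2}{16\lambda^2\pi^2B^4}.$$ The $M$ Airy beams have arbitrary reference centers $(x_{c,m},z_{c,m})\in\mathbb{R}^2$ and trajectory parameters $(B_m,F_m,\theta_m)$, with $B_m\in\mathbb{R}\setminus\{0\}$, $F_m\in\mathbb{R}\setminus\{0\}$, $\theta_m\in\mathbb{R}$, and $z_0-z_{c,m}\neq 0$. Assigning a constant phase offset $\delta_m\in\mathbb{R}$ to the $m$-th beam multiplies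 its response $g_m$ at the target by $e^{\jmath\delta_m}$; the trajectories, and hence the numbers $g_m$, are fixed. *)

theory Defs
  imports "HOL-Analysis.Analysis"
begin

text \<open>
  Airy function of the first kind on the complex plane, by its Maclaurin series: the solution of
  the Airy equation \<open>w'' = z w\<close> with \<open>w(0) = 1 / (3 powr (2/3) * Gamma (2/3))\<close> and
  \<open>w'(0) = - 1 / (3 powr (1/3) * Gamma (1/3))\<close>.  The recurrence for the coefficients is the equation
  itself; the lemmas below confirm convergence, the equation and the initial values.
\<close>

fun airy_coeff :: "nat \<Rightarrow> real" where
  "airy_coeff 0 = 1 / (3 powr (2/3) * Gamma (2/3))"
| "airy_coeff (Suc 0) = - 1 / (3 powr (1/3) * Gamma (1/3))"
| "airy_coeff (Suc (Suc 0)) = 0"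
| "airy_coeff (Suc (Suc (Suc n))) = airy_coeff n / (real (n + 2) * real (n + 3))"

definition airy_Ai :: "complex \<Rightarrow> complex" where
  "airy_Ai z = (\<Sum>n. complex_of_real (airy_coeff n) * z ^ n)"

lemma airy_coeff_bounded:
  assumes "R > 0"
  obtains M where "\<And>n. \<bar>airy_coeff n\<bar> * R ^ n \<le> M"
proof -
  define D where "D n = \<bar>airy_coeff n\<bar> * R ^ n" for n
  obtain N :: nat where N: "R ^ 3 < real N"
    using reals_Archimedean2 by blast
  have step: "D (n + 3) \<le> D n" if "n \<ge> N" for n
  proof -
    have "R ^ 3 \<le> real (n + 2) * real (n + 3)"
    proof -
      have "R ^ 3 \<le> real (n + 2) * 1" using N that by simp
      also have "\<dots> \<le> real (n + 2) * real (n + 3)" by (intro mult_left_mono) auto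
      finally show ?thesis .
    qed
    hence "R ^ 3 / (real (n + 2) * real (n + 3)) \<le> 1"
      by (intro divide_le_eq_1_pos[THEN iffD2]) auto
    hence "D n * (R ^ 3 / (real (n + 2) * real (n + 3))) \<le> D n * 1"
      using assms by (intro mult_left_mono) (auto simp: D_def)
    moreover have "D (n + 3) = D n * (R ^ 3 / (real (n + 2) * real (n + 3)))"
      using assms by (simp add: D_def eval_nat_numeral abs_mult field_simps)
    ultimately show ?thesis by simp
  qed
  define M where "M = Max (D ` {..N + 3})"
  have "D n \<le> M" for n
  proof (induction n rule: less_induct)
    case (less n)
    show ?case
    proof (cases "n \<le> N + 3")
      case True
      thus ?thesis by (auto simp: M_def intro: Max_ge)
    next
      case False
      hence "D n \<le> D (n - 3)" using step[of "n - 3"] by simp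
      also have "\<dots> \<le> M" using False by (intro less.IH) auto
      finally show ?thesis .
    qed
  qed
  thus ?thesis by (intro that[of M]) (simp add: D_def)
qed

lemma summable_airy: "summable (\<lambda>n. complex_of_real (airy_coeff n) * z ^ n)"
proof -
  obtain M where "\<bar>airy_coeff n\<bar> * (norm z + 1) ^ n \<le> M" for n
    using airy_coeff_bounded[of "norm z + 1"] by (metis add_nonneg_pos norm_ge_zero zero_less_one)
  hence "summable (\<lambda>n. norm (complex_of_real (airy_coeff n)) * norm z ^ n)"
    by (intro Abel_lemma[of _ "norm z + 1" _ M]) auto
  thus ?thesis
    by (intro summable_norm_cancel[of "\<lambda>n. complex_of_real (airy_coeff n) * z ^ n"])
       (simp add: norm_mult norm_power)
qed

lemma has_field_derivative_airy_Ai: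
  "(airy_Ai has_field_derivative
     (\<Sum>n. diffs (\<lambda>n. complex_of_real (airy_coeff n)) n * z ^ n)) (at z)"
  unfolding airy_Ai_def[abs_def]
  by (rule termdiffs_strong_converges_everywhere) (rule summable_airy)

lemma airy_Ai_holomorphic: "airy_Ai holomorphic_on A"
  using has_field_derivative_airy_Ai
  by (meson field_differentiable_at_within field_differentiable_def holomorphic_onI)

lemma airy_Ai_0: "airy_Ai 0 = complex_of_real (1 / (3 powr (2/3) * Gamma (2/3)))"
  unfolding airy_Ai_def by (subst powser_zero) simp

lemma deriv_airy_Ai_0: "deriv airy_Ai 0 = complex_of_real (- 1 / (3 powr (1/3) * Gamma (1/3)))"
  using DERIV_imp_deriv[OF has_field_derivative_airy_Ai[of 0]]
  by (simp only: powser_zero) (simp add: diffs_def)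

lemma airy_equation: "deriv (deriv airy_Ai) z = z * airy_Ai z"
proof -
  define c where "c n = complex_of_real (airy_coeff n)" for n
  have d1: "deriv airy_Ai = (\<lambda>z. \<Sum>n. diffs c n * z ^ n)"
    using DERIV_imp_deriv[OF has_field_derivative_airy_Ai] unfolding c_def[abs_def] by blast
  have s: "summable (\<lambda>n. c n * z ^ n)" for z
    using summable_airy by (simp add: c_def)
  have s1: "summable (\<lambda>n. diffs c n * z ^ n)" for z
    by (rule termdiff_converges_all) (rule s)
  have s2: "summable (\<lambda>n. diffs (diffs c) n * z ^ n)"
    by (rule termdiff_converges_all) (rule s1)
  have "deriv (deriv airy_Ai) z = (\<Sum>n. diffs (diffs c) n * z ^ n)"
    unfolding d1 by (intro DERIV_imp_deriv termdiffs_strong_converges_everywhere s1)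
  also have "\<dots> = (\<Sum>n. diffs (diffs c) (Suc n) * z ^ Suc n)"
    using suminf_split_head[OF s2] by (simp add: diffs_def c_def eval_nat_numeral)
  also have "(\<lambda>n. diffs (diffs c) (Suc n) * z ^ Suc n) = (\<lambda>n. z * (c n * z ^ n))"
  proof
    fix n
    have "diffs (diffs c) (Suc n) =
        of_real (real (n + 2) * (real (n + 3) * airy_coeff (Suc (Suc (Suc n)))))"
      by (simp add: diffs_def c_def del: airy_coeff.simps)
    also have "real (n + 2) * (real (n + 3) * airy_coeff (Suc (Suc (Suc n)))) = airy_coeff n"
      by (simp del: of_nat_add)
    finally have "diffs (diffs c) (Suc n) = c n" by (simp only: c_def[of n])
    thus "diffs (diffs c) (Suc n) * z ^ Suc n = z * (c n * z ^ n)" by simp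
  qed
  also have "(\<Sum>n. z * (c n * z ^ n)) = z * airy_Ai z"
    using suminf_mult[OF s] by (simp add: airy_Ai_def c_def)
  finally show ?thesis .
qed

definition wavenumber :: "real \<Rightarrow> real" where
  "wavenumber lam = 2 * pi / lam"

text \<open>
  \<open>inv_F_tilde\<close> is the complex number written \<open>1/F~\<close>; only this reciprocal occurs in the field.
\<close>

definition inv_F_tilde :: "real \<Rightarrow> real \<Rightarrow> real \<Rightarrow> complex" where
  "inv_F_tilde lam w0 F =
     1 / complex_of_real F - \<i> * complex_of_real (lam / (pi * w0\<^sup>2))"

definition airy_A :: "real \<Rightarrow> real" where
  "airy_A B = (2 * pi * B) ^ 3"

definition airy_C1 :: "real \<Rightarrow> real \<Rightarrow> real \<Rightarrow> real \<Rightarrow> real" where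
  "airy_C1 lam x z \<theta> = - (2 * pi / lam * sin \<theta> + 2 * pi * x / (lam * z))"

definition airy_C2 :: "real \<Rightarrow> real \<Rightarrow> real \<Rightarrow> real \<Rightarrow> complex" where
  "airy_C2 lam w0 z F =
     complex_of_real (pi / lam) * (1 / complex_of_real z - inv_F_tilde lam w0 F)"

definition airy_phi_c ::
    "real \<Rightarrow> real \<Rightarrow> real \<Rightarrow> real \<Rightarrow> real \<Rightarrow> real \<Rightarrow> real \<Rightarrow> complex" where
  "airy_phi_c lam w0 x z B F \<theta> =
     2 * airy_C2 lam w0 z F ^ 3 / (3 * complex_of_real (airy_A B) ^ 2)
     - complex_of_real (airy_C1 lam x z \<theta>) * airy_C2 lam w0 z F / complex_of_real (airy_A B)"

definition airy_xi ::
    "real \<Rightarrow> real \<Rightarrow> real \<Rightarrow> real \<Rightarrow> real \<Rightarrow> real \<Rightarrow> real \<Rightarrow> complex" where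
  "airy_xi lam w0 x z B F \<theta> =
     - complex_of_real (sin \<theta> / (lam * B)) - complex_of_real (x / (lam * z * B))
     - (1 / complex_of_real z - inv_F_tilde lam w0 F)\<^sup>2
         / complex_of_real (16 * lam\<^sup>2 * pi\<^sup>2 * B ^ 4)"

definition airy_field ::
    "real \<Rightarrow> real \<Rightarrow> real \<Rightarrow> real \<Rightarrow> real \<Rightarrow> real \<Rightarrow> real \<Rightarrow> complex" where
  "airy_field lam w0 x z B F \<theta> =
     exp (\<i> * complex_of_real (wavenumber lam * z)) / (\<i> * complex_of_real (lam * z * B))
     * exp (\<i> * complex_of_real (pi * x\<^sup>2 / (lam * z)))
     * exp (\<i> * airy_phi_c lam w0 x z B F \<theta>)
     * airy_Ai (airy_xi lam w0 x z B F \<theta>)"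

definition target_power :: "nat \<Rightarrow> (nat \<Rightarrow> complex) \<Rightarrow> (nat \<Rightarrow> real) \<Rightarrow> real" where
  "target_power M g \<delta> = (cmod (\<Sum>m=1..M. exp (\<i> * complex_of_real (\<delta> m)) * g m))\<^sup>2"

text \<open>
  Equality of principal arguments of nonzero numbers is equality of arguments modulo \<open>2\<pi>\<close>.
\<close>

definition same_phase :: "nat \<Rightarrow> (nat \<Rightarrow> complex) \<Rightarrow> (nat \<Rightarrow> real) \<Rightarrow> bool" where
  "same_phase M g \<delta> \<longleftrightarrow>
     (\<forall>m\<in>{1..M}. \<forall>n\<in>{1..M}.
        exp (\<i> * complex_of_real (\<delta> m)) * g m \<noteq> 0 \<longrightarrow>
        exp (\<i> * complex_of_real (\<delta> n)) * g n \<noteq> 0 \<longrightarrow>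
        Arg (exp (\<i> * complex_of_real (\<delta> m)) * g m) = Arg (exp (\<i> * complex_of_real (\<delta> n)) * g n))"

end

theory Submission
  imports Defs
begin

text \<open>A phase offset only rotates its term, so the triangle inequality bounds the power by a
  quantity free of the offsets (\<open>target_power_le\<close>). Equality holds when all terms lie
  on one closed ray from the origin: the sum is then a nonnegative real times a unit vector
  (\<open>target_power_common_phase\<close>). Equal arguments of the nonzero terms give such a ray
  (\<open>target_power_same_phase\<close>), and subtracting each argument from a common angle
  produces one (\<open>target_power_compensated_phase\<close>).\<close>

lemma cmod_phase_factor: "cmod (exp (\<i> * complex_of_real t) * z) = cmod z"
  by (simp add: norm_mult)

lemma target_power_le: "target_power M g \<delta> \<le> (\<Sum>m=1..M. cmod (g m))\<^sup>2"
proof -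
  have "cmod (\<Sum>m=1..M. exp (\<i> * complex_of_real (\<delta> m)) * g m)
      \<le> (\<Sum>m=1..M. cmod (exp (\<i> * complex_of_real (\<delta> m)) * g m))"
    by (rule norm_sum)
  thus ?thesis
    unfolding target_power_def cmod_phase_factor by (rule power_mono) simp
qed

text \<open>The bound of \<open>target_power_le\<close> does not depend on the offsets, so any
  offsets that reach it are maximizers.\<close>

lemma is_arg_max_target_powerI:
  assumes "target_power M g \<delta> = (\<Sum>m=1..M. cmod (g m))\<^sup>2"
  shows "is_arg_max (target_power M g) (\<lambda>_. True) \<delta>"
  using assms target_power_le[of M g] by (auto simp: is_arg_max_def not_less)

text \<open>Equality case of the triangle inequality. Writing the ray as modulus times a fixed unit
  vector, rather than through \<open>Arg\<close>, lets zero terms satisfy the condition too, so the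
  unit vector factors out of the whole sum.\<close>

lemma target_power_common_phase:
  assumes "\<And>m. m \<in> {1..M} \<Longrightarrow>
    exp (\<i> * complex_of_real (\<delta> m)) * g m = complex_of_real (cmod (g m)) * exp (\<i> * complex_of_real \<psi>)"
  shows "target_power M g \<delta> = (\<Sum>m=1..M. cmod (g m))\<^sup>2"
proof -
  have "(\<Sum>m=1..M. exp (\<i> * complex_of_real (\<delta> m)) * g m)
      = complex_of_real (\<Sum>m=1..M. cmod (g m)) * exp (\<i> * complex_of_real \<psi>)"
    unfolding of_real_sum sum_distrib_right using assms by (rule sum.cong[OF refl])
  thus ?thesis
    by (simp add: target_power_def norm_mult del: of_real_sum)
qed

lemma target_power_same_phase:
  assumes "same_phase M g \<delta>"
  shows "target_power M g \<delta> = (\<Sum>m=1..M. cmod (g m))\<^sup>2"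
proof -
  define h where "h m = exp (\<i> * complex_of_real (\<delta> m)) * g m" for m
  \<comment> \<open>The common angle is the argument of any nonzero term; if all terms vanish, any
    real number serves.\<close>
  obtain \<psi> where \<psi>: "Arg (h m) = \<psi>" if "m \<in> {1..M}" "h m \<noteq> 0" for m
    using assms unfolding same_phase_def h_def by metis
  have "h m = complex_of_real (cmod (g m)) * exp (\<i> * complex_of_real \<psi>)" if "m \<in> {1..M}" for m
  proof (cases "h m = 0")
    \<comment> \<open>The exponential never vanishes, so here \<open>g m = 0\<close> and both sides
      are zero.\<close>
    case True
    thus ?thesis by (simp add: h_def)
  next
    case False
    thus ?thesis
      using Arg_eq[of "h m"] \<psi>[OF that] by (simp add: h_def cmod_phase_factor)
  qed
  thus ?thesis
    unfolding h_def by (rule target_power_common_phase)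
qed

lemma target_power_compensated_phase:
  "target_power M g (\<lambda>m. \<phi> - Arg (g m)) = (\<Sum>m=1..M. cmod (g m))\<^sup>2"
proof (rule target_power_common_phase)
  fix m
  show "exp (\<i> * complex_of_real (\<phi> - Arg (g m))) * g m
      = complex_of_real (cmod (g m)) * exp (\<i> * complex_of_real \<phi>)"
  \<comment> \<open>For nonzero \<open>g m\<close>, the polar form cancels \<open>Arg (g m)\<close>
    against the offset; a zero term is zero on both sides, whatever value \<open>Arg 0\<close>
    has.\<close>
  proof (cases "g m = 0")
    case False
    have "exp (\<i> * complex_of_real (\<phi> - Arg (g m))) * g m
        = exp (\<i> * complex_of_real (\<phi> - Arg (g m)))
          * (complex_of_real (cmod (g m)) * exp (\<i> * complex_of_real (Arg (g m))))"
      using Arg_eq[OF False] by simp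
    also have "\<dots> = complex_of_real (cmod (g m)) * exp (\<i> * complex_of_real \<phi>)"
      by (simp add: right_diff_distrib exp_diff)
    finally show ?thesis .
  qed simp
qed

theorem theorem1:
  fixes M :: nat
    and lam w0 x0 z0 :: real
    and xc zc B F \<theta> :: "nat \<Rightarrow> real"
    and g :: "nat \<Rightarrow> complex"
  assumes "M \<ge> 1"
    and "lam > 0" and "w0 > 0"
    and "\<And>m. m \<in> {1..M} \<Longrightarrow> B m \<noteq> 0"
    and "\<And>m. m \<in> {1..M} \<Longrightarrow> F m \<noteq> 0"
    and "\<And>m. m \<in> {1..M} \<Longrightarrow> z0 - zc m \<noteq> 0"
    and "\<And>m. m \<in> {1..M} \<Longrightarrow>
           g m = airy_field lam w0 (x0 - xc m) (z0 - zc m) (B m) (F m) (\<theta> m)"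
  shows "(\<forall>\<delta>. same_phase M g \<delta> \<longrightarrow> is_arg_max (target_power M g) (\<lambda>_. True) \<delta>)
    \<and> ((\<Sum>m=1..M. cmod (g m))\<^sup>2 \<in> range (target_power M g)
       \<and> (\<forall>\<delta>. target_power M g \<delta> \<le> (\<Sum>m=1..M. cmod (g m))\<^sup>2))
    \<and> ((\<forall>m\<in>{1..M}. g m \<noteq> 0) \<longrightarrow>
        (\<forall>\<phi>\<^sub>0 :: real.
           is_arg_max (target_power M g) (\<lambda>_. True) (\<lambda>m. \<phi>\<^sub>0 - Arg (g m))
           \<and> target_power M g (\<lambda>m. \<phi>\<^sub>0 - Arg (g m)) = (\<Sum>m=1..M. cmod (g m))\<^sup>2))"
  \<comment> \<open>The compensated offsets, with any common phase, also witness that the bound lies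
    in the range.\<close>
  by (metis is_arg_max_target_powerI target_power_same_phase target_power_compensated_phase
      target_power_le rangeI)

end
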